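(* Let $n\ge 2$ be an integer and let $\theta_1=(\theta_{1,0},\dots,\theta_{1,n})^T\in\mathbb{R}^{n+1}$ be fixed with $\theta_{1,n}\neq 0$ and $\theta_{1,n-1}=0$. Put $t_i^*(0)=-\cos\left(\frac{i\pi}{n}\right)$ for $i=1,\dots,n$, and define weights $$\omega_i^*=\frac{2}{n}\sin^2\left(\frac{i\pi}{2n}\right),\qquad \omega_{n-i}^*=\frac{2}{n}\cos^2\left(\frac{i\pi}{2n}\right)\qquad \left(i=1,\dots,\left\lfloor \tfrac n2\right\rfloor\right),\qquad \omega_n^*=\frac1n .$$ Let $\xi_1$ be the design on $[-1,1]$ with mass $\omega_i^*$ at the point $t_i^*(0)$ ($i=1,\dots,n$), and let $\xi_2$ be the design with mass $\omega_i^*$ at the point $-t_i^*(0)$ ($i=1,\dots,n$). Then a design $\xi$ on $[-1,1]$ is $T$-optimal for discriminating between the models $\eta_1(x,\theta_1)=\sum_{j=0}^{n}\theta_{1,j}x^j$ and $\eta_2(x,\theta_2)=\sum_{j=0}^{n-2}\theta_{2,j}x^j$ if and only if it can be represented in the form $\xi=(1-\alpha)\xi_1+\alpha\xi_2$ for some $\alpha\in[0,1]$.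
   Context: A design on $[-1,1]$ is a probability measure on $[-1,1]$ with finite support. For a fixed parameter $\theta_1$, a design $\xi^*$ is called $T$-optimal for discriminating between $\eta_1(x,\theta_1)$ and $\eta_2(x,\theta_2)$ if it maximizes, over all designs $\xi$ on $[-1,1]$, the quantity $$\min_{\theta_2\in\mathbb{R}^{n-1}}\int_{[-1,1]}\bigl(\eta_1(x,\theta_1)-\eta_2(x,\theta_2)\bigr)^2\,\xi(dx),$$ where $\theta_2=(\theta_{2,0},\dots,\theta_{2,n-2})^T$. *)

theory Defs
  imports "HOL-Probability.Probability"
begin

section \<open>Designs and T-optimality\<close>

definition design :: "real pmf \<Rightarrow> bool" where
  "design \<xi> \<longleftrightarrow> finite (set_pmf \<xi>) \<and> set_pmf \<xi> \<subseteq> {-1..1}"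

text \<open>The infimum is attained for the linear models considered here,
  see \<open>T_criterion_attained\<close> below, so it is the minimum.\<close>

definition T_criterion ::
    "(real \<Rightarrow> 'p \<Rightarrow> real) \<Rightarrow> 'p \<Rightarrow> (real \<Rightarrow> 'q \<Rightarrow> real) \<Rightarrow> 'q set \<Rightarrow> real pmf \<Rightarrow> real" where
  "T_criterion \<eta>1 \<theta>1 \<eta>2 \<Theta>2 \<xi> =
     (INF \<theta>2\<in>\<Theta>2. measure_pmf.expectation \<xi> (\<lambda>x. (\<eta>1 x \<theta>1 - \<eta>2 x \<theta>2)\<^sup>2))"

definition T_optimal ::
    "(real \<Rightarrow> 'p \<Rightarrow> real) \<Rightarrow> 'p \<Rightarrow> (real \<Rightarrow> 'q \<Rightarrow> real) \<Rightarrow> 'q set \<Rightarrow> real pmf \<Rightarrow> bool" where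
  "T_optimal \<eta>1 \<theta>1 \<eta>2 \<Theta>2 \<xi> \<longleftrightarrow> design \<xi> \<and>
     (\<forall>\<xi>'. design \<xi>' \<longrightarrow> T_criterion \<eta>1 \<theta>1 \<eta>2 \<Theta>2 \<xi>' \<le> T_criterion \<eta>1 \<theta>1 \<eta>2 \<Theta>2 \<xi>)"

text \<open>A parameter vector in \<open>\<real>\<^sup>d\<^sup>+\<^sup>1\<close> is a function on the index set \<open>{0..d}\<close>.\<close>

definition params :: "nat \<Rightarrow> (nat \<Rightarrow> real) set" where
  "params d = ({0..d} \<rightarrow>\<^sub>E UNIV)"

definition poly_model :: "nat \<Rightarrow> real \<Rightarrow> (nat \<Rightarrow> real) \<Rightarrow> real" where
  "poly_model d x \<theta> = (\<Sum>j=0..d. \<theta> j * x ^ j)"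

section \<open>The extremal designs\<close>

text \<open>Mass \<open>w i\<close> at the point \<open>t i\<close> for \<open>i = 1, \<dots>, n\<close>; meaningful only for nonnegative
  weights with sum 1, see \<open>pmf_point_design\<close>.\<close>

definition point_design :: "nat \<Rightarrow> (nat \<Rightarrow> real) \<Rightarrow> (nat \<Rightarrow> real) \<Rightarrow> real pmf" where
  "point_design n t w = embed_pmf (\<lambda>x. \<Sum>i | i \<in> {1..n} \<and> t i = x. w i)"

definition t_star :: "nat \<Rightarrow> nat \<Rightarrow> real" where
  "t_star n i = - cos (real i * pi / real n)"

text \<open>The second branch is the rule for \<open>\<omega>\<^sub>n\<^sub>-\<^sub>k\<close> with \<open>k = n - i\<close>. For even \<open>n\<close> and
  \<open>i = n / 2\<close> both rules apply, and they agree, see \<open>omega_star_eqs\<close>.\<close>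

definition omega_star :: "nat \<Rightarrow> nat \<Rightarrow> real" where
  "omega_star n i =
     (if i = n then 1 / real n
      else if i \<le> n div 2 then 2 / real n * (sin (real i * pi / (2 * real n)))\<^sup>2
      else 2 / real n * (cos (real (n - i) * pi / (2 * real n)))\<^sup>2)"

definition xi1 :: "nat \<Rightarrow> real pmf" where
  "xi1 n = point_design n (t_star n) (omega_star n)"

definition xi2 :: "nat \<Rightarrow> real pmf" where
  "xi2 n = point_design n (\<lambda>i. - t_star n i) (omega_star n)"

section \<open>Well-definedness\<close>

lemma pmf_point_design:
  assumes nn: "\<And>i. i \<in> {1..n} \<Longrightarrow> 0 \<le> w i" and one: "(\<Sum>i=1..n. w i) = 1"
  shows "pmf (point_design n t w) x = (\<Sum>i | i \<in> {1..n} \<and> t i = x. w i)"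
proof -
  let ?f = "\<lambda>x. \<Sum>i | i \<in> {1..n} \<and> t i = x. w i"
  have f0: "0 \<le> ?f x" for x by (rule sum_nonneg) (use nn in auto)
  have supp: "x \<in> t ` {1..n}" if "?f x \<noteq> 0" for x
    by (rule ccontr) (use that in \<open>auto intro!: sum.neutral\<close>)
  have "(\<integral>\<^sup>+x. ennreal (?f x) \<partial>count_space UNIV) = (\<Sum>x\<in>t ` {1..n}. ennreal (?f x))"
  proof (rule nn_integral_count_space')
    show "ennreal (?f x) = 0" if "x \<notin> t ` {1..n}" for x
    proof -
      have "?f x = 0" using supp that by blast
      then show ?thesis by (simp only: ennreal_0)
    qed
  qed auto
  also have "\<dots> = ennreal (\<Sum>x\<in>t ` {1..n}. ?f x)"
    by (rule sum_ennreal) (rule f0)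
  also have "(\<Sum>x\<in>t ` {1..n}. ?f x) = (\<Sum>i=1..n. w i)"
    by (rule sum.image_gen [symmetric]) simp
  finally have "(\<integral>\<^sup>+x. ennreal (?f x) \<partial>count_space UNIV) = 1"
    using one by simp
  then show ?thesis
    unfolding point_design_def by (intro pmf_embed_pmf f0)
qed

lemma omega_star_eqs:
  assumes n: "2 \<le> n"
  shows "i \<in> {1..n div 2} \<Longrightarrow> omega_star n i = 2 / real n * (sin (real i * pi / (2 * real n)))\<^sup>2"
    and "i \<in> {1..n div 2} \<Longrightarrow> omega_star n (n - i) = 2 / real n * (cos (real i * pi / (2 * real n)))\<^sup>2"
    and "omega_star n n = 1 / real n"
proof -
  show "omega_star n i = 2 / real n * (sin (real i * pi / (2 * real n)))\<^sup>2" if "i \<in> {1..n div 2}"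
    using that n by (auto simp: omega_star_def)
  show "omega_star n n = 1 / real n" by (simp add: omega_star_def)
  show "omega_star n (n - i) = 2 / real n * (cos (real i * pi / (2 * real n)))\<^sup>2" if i: "i \<in> {1..n div 2}"
  proof (cases "n - i \<le> n div 2")
    case False
    have "n - (n - i) = i" "n - i \<noteq> n" using i n by auto
    with False show ?thesis by (simp add: omega_star_def)
  next
    case True
    have ni: "n = 2 * i" using i True by auto
    have "real i * pi / (2 * real n) = pi / 4" using ni n by simp
    moreover have "n - i = i" "i \<noteq> n" "i \<le> n div 2" using ni n by auto
    ultimately show ?thesis by (simp only: omega_star_def if_False if_True sin_45 cos_45)
  qed
qed

lemma omega_star_refl:
  assumes n: "2 \<le> n" and i: "i \<in> {1..n-1}"
  shows "omega_star n i + omega_star n (n - i) = 2 / real n"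
proof -
  have *: "omega_star n k + omega_star n (n - k) = 2 / real n" if "k \<in> {1..n div 2}" for k
    unfolding omega_star_eqs(1,2)[OF n that] distrib_left[symmetric] by simp
  show ?thesis
  proof (cases "i \<le> n div 2")
    case True with i show ?thesis by (intro *) auto
  next
    case False
    with i have "n - i \<in> {1..n div 2}" "n - (n - i) = i" by auto
    with *[of "n - i"] show ?thesis by simp
  qed
qed

lemma omega_star_nonneg: "0 \<le> omega_star n i"
  by (simp add: omega_star_def)

lemma sum_omega_star:
  assumes n: "2 \<le> n"
  shows "(\<Sum>i=1..n. omega_star n i) = 1"
proof -
  let ?S = "\<Sum>i=1..n-1. omega_star n i"
  have "?S = (\<Sum>i=1..n-1. omega_star n (n - i))"
    by (rule sum.reindex_bij_witness [of _ "\<lambda>i. n - i" "\<lambda>i. n - i"]) auto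
  then have "2 * ?S = (\<Sum>i=1..n-1. omega_star n i + omega_star n (n - i))"
    by (simp add: sum.distrib)
  also have "\<dots> = (\<Sum>i=1..n-1. 2 / real n)"
    by (rule sum.cong) (use omega_star_refl[OF n] in auto)
  also have "\<dots> = 2 * (real n - 1) / real n" using n by (simp add: of_nat_diff)
  finally have S: "?S = (real n - 1) / real n" using n by (simp add: field_simps)
  have "{1..n} = insert n {1..n-1}" using n by auto
  then have "(\<Sum>i=1..n. omega_star n i) = 1 / real n + ?S"
    using n by (simp add: omega_star_eqs(3))
  then show ?thesis using S n by (simp add: field_simps)
qed

lemma pmf_xi1:
  "2 \<le> n \<Longrightarrow> pmf (xi1 n) x = (\<Sum>i | i \<in> {1..n} \<and> t_star n i = x. omega_star n i)"
  unfolding xi1_def by (intro pmf_point_design omega_star_nonneg sum_omega_star)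

lemma pmf_xi2:
  "2 \<le> n \<Longrightarrow> pmf (xi2 n) x = (\<Sum>i | i \<in> {1..n} \<and> - t_star n i = x. omega_star n i)"
  unfolding xi2_def by (intro pmf_point_design omega_star_nonneg sum_omega_star)

lemma normal_equations:
  fixes f :: "real \<Rightarrow> real" and g :: "nat \<Rightarrow> real \<Rightarrow> real"
  assumes S: "finite S" and p: "\<And>x. 0 \<le> p x"
  shows "\<exists>\<theta>. \<forall>i<k. (\<Sum>x\<in>S. (f x - (\<Sum>j<k. \<theta> j * g j x)) * g i x * p x) = 0"
proof (induction k arbitrary: f)
  case 0 show ?case by simp
next
  case (Suc k)
  obtain \<theta> where \<theta>: "\<forall>i<k. (\<Sum>x\<in>S. (f x - (\<Sum>j<k. \<theta> j * g j x)) * g i x * p x) = 0"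
    using Suc by blast
  obtain \<phi> where \<phi>: "\<forall>i<k. (\<Sum>x\<in>S. (g k x - (\<Sum>j<k. \<phi> j * g j x)) * g i x * p x) = 0"
    using Suc by blast
  define ip where "ip u v = (\<Sum>x\<in>S. u x * v x * p x)" for u v :: "real \<Rightarrow> real"
  have ip_diff: "ip (\<lambda>x. a x - b x) v = ip a v - ip b v" for a b v
    by (simp add: ip_def algebra_simps sum_subtractf)
  have ip_scale: "ip (\<lambda>x. c * a x) v = c * ip a v" for a c v
    by (simp add: ip_def sum_distrib_left mult_ac)
  have ip_commute: "ip a v = ip v a" for a v
    by (simp add: ip_def mult_ac)
  have ip_sum: "ip (\<lambda>x. \<Sum>j<k. c j * a j x) v = (\<Sum>j<k. c j * ip (a j) v)" for c a v
  proof -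
    have "ip (\<lambda>x. \<Sum>j<k. c j * a j x) v = (\<Sum>x\<in>S. \<Sum>j<k. c j * (a j x * v x * p x))"
      unfolding ip_def sum_distrib_right by (intro sum.cong refl) (simp add: mult_ac)
    also have "\<dots> = (\<Sum>j<k. \<Sum>x\<in>S. c j * (a j x * v x * p x))" by (rule sum.swap)
    finally show ?thesis by (simp add: ip_def sum_distrib_left)
  qed
  define u where "u x = f x - (\<Sum>j<k. \<theta> j * g j x)" for x
  define v where "v x = g k x - (\<Sum>j<k. \<phi> j * g j x)" for x
  have u: "ip u (g i) = 0" if "i < k" for i using \<theta> that by (simp add: ip_def u_def)
  have v: "ip v (g i) = 0" if "i < k" for i using \<phi> that by (simp add: ip_def v_def)
  have g: "g k = (\<lambda>x. v x - (\<Sum>j<k. (- \<phi> j) * g j x))"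
    by (auto simp: v_def sum_negf)
  have ipg: "ip (g k) w = ip v w - (\<Sum>j<k. (- \<phi> j) * ip (g j) w)" for w
    by (subst g) (simp only: ip_diff ip_sum)
  have vv: "ip v (g k) = ip v v"
  proof -
    have "ip (g i) v = 0" if "i < k" for i
      using v[OF that] ip_commute[of "g i" v] by simp
    then have "ip (g k) v = ip v v" using ipg[of v] by simp
    then show ?thesis using ip_commute[of v "g k"] ip_commute[of v v] by metis
  qed
  have uv: "ip u (g k) = ip u v"
  proof -
    have "ip (g i) u = 0" if "i < k" for i
      using u[OF that] ip_commute[of "g i" u] by simp
    then have "ip (g k) u = ip v u" using ipg[of u] by simp
    then show ?thesis using ip_commute[of u "g k"] ip_commute[of u v] by metis
  qed
  define c where "c = ip u (g k) / ip v (g k)"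
  have c: "ip u (g k) = c * ip v (g k)"
  proof (cases "ip v (g k) = 0")
    case True
    have "(\<Sum>x\<in>S. v x * v x * p x) = 0" using True vv by (simp add: ip_def)
    then have "\<forall>x\<in>S. v x * v x * p x = 0"
      using S p by (subst (asm) sum_nonneg_eq_0_iff) auto
    then have "ip u v = 0" by (auto simp: ip_def intro!: sum.neutral)
    with uv True show ?thesis by simp
  qed (simp add: c_def)
  define \<theta>' where "\<theta>' j = (if j = k then c else \<theta> j - c * \<phi> j)" for j
  have res: "f x - (\<Sum>j<Suc k. \<theta>' j * g j x) = u x - c * v x" for x
    by (simp add: \<theta>'_def u_def v_def algebra_simps sum_subtractf sum_distrib_left)
  have "(\<Sum>x\<in>S. (f x - (\<Sum>j<Suc k. \<theta>' j * g j x)) * g i x * p x) = 0" if "i < Suc k" for i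
  proof -
    have "ip (\<lambda>x. u x - c * v x) (g i) = ip u (g i) - c * ip v (g i)"
      by (simp only: ip_diff ip_scale)
    also have "\<dots> = 0" using u v c that by (cases "i = k") auto
    finally show ?thesis unfolding res ip_def .
  qed
  then show ?case by blast
qed

lemma T_criterion_attained:
  assumes "design \<xi>"
  shows "\<exists>\<theta>2\<in>params d.
    T_criterion \<eta> \<theta>1 (poly_model d) (params d) \<xi> =
      measure_pmf.expectation \<xi> (\<lambda>x. (\<eta> x \<theta>1 - poly_model d x \<theta>2)\<^sup>2) \<and>
    (\<forall>\<theta>\<in>params d. measure_pmf.expectation \<xi> (\<lambda>x. (\<eta> x \<theta>1 - poly_model d x \<theta>2)\<^sup>2)
      \<le> measure_pmf.expectation \<xi> (\<lambda>x. (\<eta> x \<theta>1 - poly_model d x \<theta>)\<^sup>2))"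
proof -
  let ?S = "set_pmf \<xi>" and ?f = "\<lambda>x. \<eta> x \<theta>1"
  define E where "E \<theta> = measure_pmf.expectation \<xi> (\<lambda>x. (?f x - poly_model d x \<theta>)\<^sup>2)" for \<theta>
  have S: "finite ?S" using assms by (simp add: design_def)
  have E: "E \<theta> = (\<Sum>x\<in>?S. (?f x - poly_model d x \<theta>)\<^sup>2 * pmf \<xi> x)" for \<theta>
    unfolding E_def by (rule integral_measure_pmf_real[OF S]) auto
  have pm: "poly_model d x \<theta> = (\<Sum>j<Suc d. \<theta> j * x ^ j)" for x \<theta>
    unfolding poly_model_def by (simp add: atLeast0AtMost lessThan_Suc_atMost)
  obtain \<theta>0 where 0: "\<And>i. i < Suc d \<Longrightarrow>
      (\<Sum>x\<in>?S. (?f x - (\<Sum>j<Suc d. \<theta>0 j * x ^ j)) * x ^ i * pmf \<xi> x) = 0"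
    using normal_equations[OF S, of "pmf \<xi>" "Suc d" ?f "\<lambda>j x. x ^ j"] by auto
  define \<theta>2 where "\<theta>2 = restrict \<theta>0 {0..d}"
  have in2: "\<theta>2 \<in> params d" by (simp add: \<theta>2_def params_def)
  have pm2: "poly_model d x \<theta>2 = poly_model d x \<theta>0" for x
    unfolding poly_model_def \<theta>2_def by (rule sum.cong) auto
  define r where "r x = ?f x - poly_model d x \<theta>0" for x
  have min: "E \<theta>2 \<le> E \<theta>" for \<theta>
  proof -
    define q where "q x = poly_model d x \<theta>0 - poly_model d x \<theta>" for x
    have q: "q x = (\<Sum>j<Suc d. (\<theta>0 j - \<theta> j) * x ^ j)" for x
      unfolding q_def pm by (simp add: algebra_simps sum_subtractf)
    have "(\<Sum>x\<in>?S. r x * q x * pmf \<xi> x)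
        = (\<Sum>x\<in>?S. \<Sum>j<Suc d. (\<theta>0 j - \<theta> j) * (r x * x ^ j * pmf \<xi> x))"
      unfolding q sum_distrib_left sum_distrib_right by (intro sum.cong refl) (simp add: mult_ac)
    also have "\<dots> = (\<Sum>j<Suc d. (\<theta>0 j - \<theta> j) * (\<Sum>x\<in>?S. r x * x ^ j * pmf \<xi> x))"
      unfolding sum_distrib_left by (rule sum.swap)
    also have "\<dots> = 0"
      by (rule sum.neutral) (use 0 in \<open>simp add: r_def pm del: sum.lessThan_Suc\<close>)
    finally have orth: "(\<Sum>x\<in>?S. r x * q x * pmf \<xi> x) = 0" .
    have "E \<theta> = (\<Sum>x\<in>?S. (r x + q x)\<^sup>2 * pmf \<xi> x)"
      unfolding E r_def q_def by simp
    also have "\<dots> = (\<Sum>x\<in>?S. (r x)\<^sup>2 * pmf \<xi> x + 2 * (r x * q x * pmf \<xi> x) + (q x)\<^sup>2 * pmf \<xi> x)"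
      by (rule sum.cong) (auto simp: power2_eq_square algebra_simps)
    also have "\<dots> = E \<theta>2 + (\<Sum>x\<in>?S. (q x)\<^sup>2 * pmf \<xi> x)"
      unfolding sum.distrib sum_distrib_left[symmetric] orth E pm2 by (simp add: r_def)
    finally show ?thesis by (simp add: sum_nonneg)
  qed
  have "(INF \<theta>\<in>params d. E \<theta>) = E \<theta>2"
    by (rule cInf_eq_minimum) (use in2 min in auto)
  with in2 min show ?thesis unfolding E_def T_criterion_def by blast
qed

end

theory Submission
  imports Defs
begin

text \<open>
  Since \<open>\<theta>\<^sub>1\<^sub>,\<^sub>n\<^sub>-\<^sub>1 = 0\<close>, a suitable choice of \<open>\<theta>\<^sub>2\<close> leaves the residual \<open>c T\<^sub>n\<close>, where \<open>T\<^sub>n\<close> is the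
  Chebyshev polynomial and \<open>c = \<theta>\<^sub>1\<^sub>,\<^sub>n / 2\<^sup>n\<^sup>-\<^sup>1\<close>. As \<open>\<bar>T\<^sub>n\<bar> \<le> 1\<close>, no design has a criterion value above
  \<open>c\<^sup>2\<close>, and a design attains \<open>c\<^sup>2\<close> iff it is carried by the extremal points of \<open>T\<^sub>n\<close> and \<open>T\<^sub>n\<close> is
  orthogonal to all polynomials of degree at most \<open>n - 2\<close> with respect to it.
  The alternating trapezoidal rule at the extremal points \<open>t\<^sub>0, \<dots>, t\<^sub>n\<close> annihilates polynomials of degree
  less than \<open>n\<close>. Hence the weights \<open>v\<^sub>i (a + b t\<^sub>i)\<close>, with \<open>v\<^sub>i\<close> the trapezoidal weights, are orthogonal
  in this sense; there are no others, because an orthogonal weight vector vanishing at both ends is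
  zero. The designs \<open>\<xi>\<^sub>1\<close> and \<open>\<xi>\<^sub>2\<close> have the weights \<open>v\<^sub>i (1 + t\<^sub>i)\<close> and \<open>v\<^sub>i (1 - t\<^sub>i)\<close>.
\<close>

subsection \<open>Chebyshev polynomials\<close>

fun cheb :: "nat \<Rightarrow> real poly" where
  "cheb 0 = 1"
| "cheb (Suc 0) = [:0, 1:]"
| "cheb (Suc (Suc n)) = [:0, 2:] * cheb (Suc n) - cheb n"

lemma poly_cheb_cos: "poly (cheb n) (cos t) = cos (real n * t)"
proof (induction n rule: cheb.induct)
  case (3 n)
  have "cos (real (Suc (Suc n)) * t) + cos (real n * t) = 2 * cos t * cos (real (Suc n) * t)"
    using cos_add[of "real (Suc n) * t" t] cos_diff[of "real (Suc n) * t" t]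
    by (simp add: algebra_simps)
  with 3 show ?case by simp
qed auto

lemma degree_cheb: "degree (cheb n) \<le> n"
proof (induction n rule: cheb.induct)
  case (3 n)
  have "degree ([:0, 2:] * cheb (Suc n)) \<le> Suc (Suc n)"
    using degree_mult_le[of "[:0, 2:]" "cheb (Suc n)"] 3 by simp
  with 3 show ?case by (auto intro!: degree_diff_le)
qed auto

lemma coeff_cheb_top: "coeff (cheb (Suc n)) (Suc n) = 2 ^ n"
proof (induction n)
  case (Suc n)
  have "coeff (cheb n) (Suc (Suc n)) = 0"
    using degree_cheb[of n] by (intro coeff_eq_0) auto
  with Suc show ?case by simp
qed simp

text \<open>Together with \<open>\<theta>1 (n - 1) = 0\<close>, this lets a multiple of
  \<open>cheb n\<close> match the first model in degree \<open>n - 1\<close>.\<close>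

lemma coeff_cheb_subtop: "coeff (cheb (Suc n)) n = 0"
proof (induction n)
  case (Suc n)
  have "coeff (cheb n) (Suc n) = 0"
    using degree_cheb[of n] by (intro coeff_eq_0) auto
  with Suc show ?case by simp
qed simp

lemma cheb_sq_le_1:
  assumes "x \<in> {-1..1}"
  shows "(poly (cheb n) x)\<^sup>2 \<le> 1"
proof -
  have "poly (cheb n) x = cos (real n * arccos x)"
    using poly_cheb_cos[of n "arccos x"] assms by simp
  then show ?thesis by (simp add: abs_square_le_1)
qed

subsection \<open>The extremal points\<close>

lemma t_star_eq_cos: "t_star n i = cos (pi - real i * pi / real n)"
  by (simp add: t_star_def)

lemma t_star_0 [simp]: "t_star n 0 = -1"
  by (simp add: t_star_def)

lemma t_star_n: "n > 0 \<Longrightarrow> t_star n n = 1"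
  by (simp add: t_star_def)

lemma t_star_reflect:
  assumes "i \<le> n" "n > 0"
  shows "t_star n (n - i) = - t_star n i"
proof -
  have "real (n - i) * pi / real n = pi - real i * pi / real n"
    using assms by (simp add: of_nat_diff field_simps)
  then show ?thesis by (simp add: t_star_def)
qed

lemma t_star_bounds: "t_star n i \<in> {-1..1}"
  by (simp add: t_star_def minus_le_iff)

lemma inj_on_t_star:
  assumes "n > 0"
  shows "inj_on (t_star n) {0..n}"
proof (rule inj_onI)
  fix i j assume i: "i \<in> {0..n}" and j: "j \<in> {0..n}" and eq: "t_star n i = t_star n j"
  have "real i * pi / real n = real j * pi / real n"
    by (rule cos_inj_pi) (use i j eq assms in \<open>auto simp: t_star_def field_simps\<close>)
  with assms show "i = j" by simp
qed

text \<open>The sign is split so that the constant factor \<open>(-1) ^ n\<close> can be pulled out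
  of sums over \<open>i\<close>, which leaves alternating sums.\<close>

lemma poly_cheb_t_star:
  assumes "i \<le> n" "n > 0"
  shows "poly (cheb n) (t_star n i) = (-1) ^ n * (-1) ^ i"
proof -
  have "real n * (pi - real i * pi / real n) = real (n - i) * pi"
    using assms by (simp add: of_nat_diff field_simps)
  then have "poly (cheb n) (t_star n i) = (-1) ^ (n - i)"
    unfolding t_star_eq_cos poly_cheb_cos by (simp only: cos_npi)
  also have "\<dots> = (-1) ^ n * (-1) ^ i"
    using assms by (simp add: minus_one_power_iff)
  finally show ?thesis .
qed

text \<open>With x = cos t the condition forces sin (n t) = 0, so n t is a multiple of pi.\<close>

lemma cheb_sq_eq_1_imp:
  assumes "n > 0" "x \<in> {-1..1}" "(poly (cheb n) x)\<^sup>2 = 1"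
  shows "x \<in> t_star n ` {0..n}"
proof -
  define t where "t = arccos x"
  have t: "0 \<le> t" "t \<le> pi" "cos t = x"
    using assms(2) by (auto simp: t_def arccos_lbound arccos_ubound)
  have "(cos (real n * t))\<^sup>2 = 1" using assms(3) poly_cheb_cos[of n t] t by simp
  then have "sin (real n * t) = 0" using sin_squared_eq[of "real n * t"] by simp
  then obtain k :: int where k: "real n * t = of_int k * pi"
    by (auto simp: sin_zero_iff_int2)
  then have teq: "t = of_int k * pi / real n" using assms(1) by (simp add: field_simps)
  have "0 \<le> of_int k * pi" using k t by (metis mult_nonneg_nonneg of_nat_0_le_iff)
  then have k0: "0 \<le> k" using pi_gt_zero by (auto simp: zero_le_mult_iff)
  have "of_int k * pi \<le> real n * pi" using k t(2) by (metis mult_left_mono of_nat_0_le_iff)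
  then have kn: "k \<le> int n" by simp
  \<comment> \<open>\<open>t_star n\<close> increases with its index while cos decreases on [0, pi],
    so cos (k pi / n) is the point with index n - k.\<close>
  have "x = t_star n (n - nat k)"
    using t_star_reflect[of "nat k" n] t teq k0 kn assms(1) by (simp add: t_star_def)
  then show ?thesis by auto
qed

subsection \<open>Orthogonality\<close>

text \<open>The trapezoidal rule at equally spaced angles in [0, pi], normalized to total weight 1
  for n > 0.\<close>

definition trap_weight :: "nat \<Rightarrow> nat \<Rightarrow> real" where
  "trap_weight n i = (if i = 0 \<or> i = n then 1 / (2 * real n) else 1 / real n)"

text \<open>Summing over neighbouring pairs absorbs the half weights at the ends and prepares the
  telescoping below.\<close>

lemma trap_weight_sum:
  assumes "n > 0"
  shows "(\<Sum>i=0..n. trap_weight n i * f i) = (\<Sum>i<n. f i + f (Suc i)) / (2 * real n)"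
proof -
  obtain m where m: "n = Suc m" using assms by (cases n) auto
  have 1: "(\<Sum>i<n. f i) = f 0 + (\<Sum>i=1..m. f i)"
    unfolding m by (simp add: sum.lessThan_Suc_shift sum.atLeast1_atMost_eq del: sum.lessThan_Suc)
  have 2: "(\<Sum>i<n. f (Suc i)) = (\<Sum>i=1..m. f i) + f n"
    unfolding m by (simp add: sum.atLeast1_atMost_eq)
  have 3: "(\<Sum>i=1..m. trap_weight n i * f i) = (\<Sum>i=1..m. f i) / real n"
    unfolding sum_divide_distrib by (rule sum.cong) (auto simp: m trap_weight_def)
  have "{0..n} = insert 0 (insert n {1..m})" by (auto simp: m)
  then have "(\<Sum>i=0..n. trap_weight n i * f i)
      = trap_weight n 0 * f 0 + (trap_weight n n * f n + (\<Sum>i=1..m. trap_weight n i * f i))"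
    by (simp add: m)
  also have "\<dots> = (f 0 + 2 * (\<Sum>i=1..m. f i) + f n) / (2 * real n)"
    unfolding 3 using assms by (simp add: trap_weight_def field_simps)
  finally show ?thesis by (simp add: sum.distrib 1 2)
qed

text \<open>By the sum-to-product formulas, cos (\<psi> / 2) (cos (i \<psi>) - cos ((i + 1) \<psi>))
  equals sin (\<psi> / 2) (sin ((i + 1) \<psi>) + sin (i \<psi>)), and with alternating signs these
  terms telescope.\<close>

lemma alternating_cos_telescope:
  "cos (\<psi> / 2) * (\<Sum>i<m. (-1) ^ i * cos (real i * \<psi>) + (-1) ^ Suc i * cos (real (Suc i) * \<psi>))
    = - ((-1) ^ m * sin (real m * \<psi>) * sin (\<psi> / 2))"
proof (induction m)
  case (Suc m)
  have "cos (\<psi> / 2) * (cos (real m * \<psi>) - cos (real m * \<psi> + \<psi>))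
      = sin (real m * \<psi> + \<psi>) * sin (\<psi> / 2) + sin (real m * \<psi>) * sin (\<psi> / 2)"
    using cos_diff_cos[of "real m * \<psi>" "real m * \<psi> + \<psi>"]
      sin_plus_sin[of "real m * \<psi> + \<psi>" "real m * \<psi>"]
    by (simp add: add_ac flip: distrib_right)
  with Suc show ?case
    by (simp add: algebra_simps)
qed simp

lemma alternating_cos_sum:
  assumes "k < n"
  shows "(\<Sum>i=0..n. trap_weight n i * ((-1) ^ i * cos (real k * (real i * pi / real n)))) = 0"
proof -
  define \<psi> where "\<psi> = real k * pi / real n"
  \<comment> \<open>\<open>k < n\<close> keeps \<psi> below pi, so the factor cos (\<psi> / 2) can
    be cancelled from the telescoped identity.\<close>
  have "\<psi> / 2 < pi / 2" "0 \<le> \<psi>" using assms by (auto simp: \<psi>_def field_simps)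
  then have "cos (\<psi> / 2) > 0" by (intro cos_gt_zero_pi) auto
  moreover have "real n * \<psi> = real k * pi" using assms by (simp add: \<psi>_def)
  then have "sin (real n * \<psi>) = 0" by simp
  ultimately have "(\<Sum>i<n. (-1) ^ i * cos (real i * \<psi>) + (-1) ^ Suc i * cos (real (Suc i) * \<psi>)) = 0"
    using alternating_cos_telescope[of \<psi> n] by simp
  moreover have "real k * (real i * pi / real n) = real i * \<psi>" for i by (simp add: \<psi>_def)
  ultimately show ?thesis using assms by (simp add: trap_weight_sum)
qed

text \<open>Product-to-sum trades one power of the cosine for the frequencies k + 1 and k - 1. So m
  + k never grows, and the induction ends in pure cosines.\<close>

lemma alternating_cos_power_sum:
  assumes "m + k < n"
  shows "(\<Sum>i=0..n. trap_weight n i * ((-1) ^ i *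
            (cos (real i * pi / real n) ^ m * cos (real k * (real i * pi / real n))))) = 0"
  using assms
proof (induction m arbitrary: k)
  case 0
  then show ?case using alternating_cos_sum[of k n] by simp
next
  case (Suc m)
  show ?case
  proof (cases k)
    \<comment> \<open>Frequency 0 has no predecessor, but the surplus cosine factor is itself the
      term of frequency 1.\<close>
    case 0
    with Suc.IH[of 1] Suc.prems show ?thesis by (simp add: mult_ac)
  next
    case (Suc l)
    let ?a = "\<lambda>i. real i * pi / real n"
    have *: "cos (?a i) * cos (real k * ?a i)
        = (cos (real (Suc k) * ?a i) + cos (real l * ?a i)) / 2" for i
    proof -
      have "real (Suc k) * ?a i = real k * ?a i + ?a i" "real l * ?a i = real k * ?a i - ?a i"
        by (simp_all only: Suc of_nat_Suc distrib_right)
      then show ?thesis by (simp only: cos_add cos_diff) (simp add: mult.commute)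
    qed
    have "trap_weight n i * ((-1) ^ i * (cos (?a i) ^ Suc m * cos (real k * ?a i)))
        = trap_weight n i * ((-1) ^ i * (cos (?a i) ^ m * cos (real (Suc k) * ?a i))) / 2
        + trap_weight n i * ((-1) ^ i * (cos (?a i) ^ m * cos (real l * ?a i))) / 2" for i
    proof -
      have "cos (?a i) ^ Suc m * cos (real k * ?a i) = cos (?a i) ^ m * (cos (?a i) * cos (real k * ?a i))"
        by simp
      then show ?thesis
        unfolding * by (simp only: distrib_left add_divide_distrib times_divide_eq_right)
    qed
    then show ?thesis
      using Suc.IH[of "Suc k"] Suc.IH[of l] Suc.prems Suc
      by (simp add: sum.distrib flip: sum_divide_distrib)
  qed
qed

lemma alternating_poly_sum:
  assumes "degree p < n"
  shows "(\<Sum>i=0..n. trap_weight n i * ((-1) ^ i * poly p (t_star n i))) = 0"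
proof -
  have mono: "(\<Sum>i=0..n. trap_weight n i * ((-1) ^ i * t_star n i ^ m)) = 0" if "m < n" for m
  proof -
    have "(\<Sum>i=0..n. trap_weight n i * ((-1) ^ i * t_star n i ^ m))
        = (-1) ^ m * (\<Sum>i=0..n. trap_weight n i * ((-1) ^ i * cos (real i * pi / real n) ^ m))"
      unfolding sum_distrib_left
      by (intro sum.cong refl) (simp add: t_star_def power_minus[of "cos _"])
    also have "\<dots> = 0" using alternating_cos_power_sum[of m 0 n] that by simp
    finally show ?thesis .
  qed
  have "(\<Sum>i=0..n. trap_weight n i * ((-1) ^ i * poly p (t_star n i)))
      = (\<Sum>i=0..n. \<Sum>m\<le>degree p. coeff p m * (trap_weight n i * ((-1) ^ i * t_star n i ^ m)))"
    unfolding poly_altdef sum_distrib_left by (intro sum.cong refl) (simp add: mult_ac)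
  also have "\<dots> = (\<Sum>m\<le>degree p. coeff p m * (\<Sum>i=0..n. trap_weight n i * ((-1) ^ i * t_star n i ^ m)))"
    unfolding sum_distrib_left by (rule sum.swap)
  also have "\<dots> = 0" by (rule sum.neutral) (use mono assms in auto)
  finally show ?thesis .
qed

subsection \<open>Designs on the extremal points\<close>

lemma expectation_on_t_star:
  assumes "n > 0" "set_pmf \<xi> \<subseteq> t_star n ` {0..n}"
  shows "measure_pmf.expectation \<xi> f = (\<Sum>i=0..n. f (t_star n i) * pmf \<xi> (t_star n i))"
proof -
  have "measure_pmf.expectation \<xi> f = (\<Sum>x\<in>t_star n ` {0..n}. f x * pmf \<xi> x)"
    by (rule integral_measure_pmf_real) (use assms(2) in \<open>auto simp: set_pmf_iff\<close>)
  then show ?thesis by (simp add: sum.reindex[OF inj_on_t_star[OF assms(1)]])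
qed

text \<open>The half-angle formula 2 sin^2 (i pi / (2 n)) = 1 - cos (i pi / n) merges both
  trigonometric branches. At \<open>i = n\<close> the factor 1 + t_n = 2 compensates the half
  trapezoidal weight.\<close>

lemma omega_star_eq:
  assumes "2 \<le> n" "i \<in> {1..n}"
  shows "omega_star n i = trap_weight n i * (1 + t_star n i)"
proof -
  have s: "2 * (sin (real i * pi / (2 * real n)))\<^sup>2 = 1 + t_star n i"
    using cos_double_sin[of "real i * pi / (2 * real n)"] by (simp add: t_star_def)
  consider "i = n" | "i \<noteq> n" "i \<le> n div 2" | "i \<noteq> n" "\<not> i \<le> n div 2" by blast
  then show ?thesis
  proof cases
    case 1 with assms show ?thesis by (simp add: omega_star_def trap_weight_def t_star_n)
  next
    case 2 with assms s show ?thesis by (simp add: omega_star_def trap_weight_def field_simps)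
  next
    case 3
    have "real (n - i) * pi / (2 * real n) = pi / 2 - real i * pi / (2 * real n)"
      using assms by (simp add: of_nat_diff field_simps)
    then have "cos (real (n - i) * pi / (2 * real n)) = sin (real i * pi / (2 * real n))"
      by (simp add: sin_cos_eq)
    with 3 assms s show ?thesis by (simp add: omega_star_def trap_weight_def field_simps)
  qed
qed

lemma pmf_xi1_t_star:
  assumes n: "2 \<le> n" and i: "i \<le> n"
  shows "pmf (xi1 n) (t_star n i) = trap_weight n i * (1 + t_star n i)"
proof -
  have eq: "t_star n j = t_star n i \<longleftrightarrow> j = i" if "j \<in> {1..n}" for j
    using inj_on_t_star[of n] n i that by (auto dest: inj_onD)
  \<comment> \<open>Index 0 carries no mass of \<open>xi1\<close>, in accordance with 1 + t_0 =
    0.\<close>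
  have "{j. j \<in> {1..n} \<and> t_star n j = t_star n i} = (if i = 0 then {} else {i})"
    using eq i by auto
  then show ?thesis
    using n i omega_star_eq[of n i] by (simp add: pmf_xi1)
qed

lemma pmf_xi2_eq:
  assumes "2 \<le> n"
  shows "pmf (xi2 n) x = pmf (xi1 n) (- x)"
  unfolding pmf_xi1[OF assms] pmf_xi2[OF assms] by (rule sum.cong) auto

lemma pmf_xi2_t_star:
  assumes n: "2 \<le> n" and i: "i \<le> n"
  shows "pmf (xi2 n) (t_star n i) = trap_weight n i * (1 - t_star n i)"
proof -
  have "- t_star n i = t_star n (n - i)" using t_star_reflect[of i n] n i by simp
  then show ?thesis
    using n i pmf_xi1_t_star[of n "n - i"] by (auto simp: pmf_xi2_eq trap_weight_def)
qed

lemma set_pmf_xi1: "2 \<le> n \<Longrightarrow> set_pmf (xi1 n) \<subseteq> t_star n ` {0..n}"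
proof
  fix x assume n: "2 \<le> n" and "x \<in> set_pmf (xi1 n)"
  then have "{i. i \<in> {1..n} \<and> t_star n i = x} \<noteq> {}"
    unfolding set_pmf_iff pmf_xi1[OF n] by (metis sum.empty)
  then show "x \<in> t_star n ` {0..n}" by auto
qed

lemma set_pmf_xi2:
  assumes n: "2 \<le> n"
  shows "set_pmf (xi2 n) \<subseteq> t_star n ` {0..n}"
proof
  fix x assume "x \<in> set_pmf (xi2 n)"
  then have "- x \<in> set_pmf (xi1 n)" by (simp add: set_pmf_iff pmf_xi2_eq[OF n])
  then obtain i where i: "i \<le> n" "- x = t_star n i" using set_pmf_xi1[OF n] by auto
  then have "x = t_star n (n - i)" using t_star_reflect[of i n] n by simp
  then show "x \<in> t_star n ` {0..n}" by auto
qed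

section \<open>Orthogonality characterizes the mixtures\<close>

definition cheb_orthogonal :: "nat \<Rightarrow> real pmf \<Rightarrow> bool" where
  "cheb_orthogonal n \<xi> \<longleftrightarrow> (\<forall>q. degree q \<le> n - 2 \<longrightarrow>
     measure_pmf.expectation \<xi> (\<lambda>x. poly (cheb n) x * poly q x) = 0)"

text \<open>On the extremal points \<open>cheb n\<close> reduces to alternating signs, and
  \<open>q\<close> times a linear factor still has degree below \<open>n\<close>, so
  \<open>alternating_poly_sum\<close> applies.\<close>

lemma cheb_orthogonal_linear_weight:
  assumes n: "2 \<le> n" and q: "degree q \<le> n - 2"
  shows "(\<Sum>i=0..n. poly (cheb n) (t_star n i) * poly q (t_star n i) *
            (trap_weight n i * (a + b * t_star n i))) = 0"
proof -
  have "degree (q * [:a, b:]) < n"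
    using degree_mult_le[of q "[:a, b:]"] q n by (auto split: if_splits)
  then have "(-1) ^ n * (\<Sum>i=0..n. trap_weight n i * ((-1) ^ i * poly (q * [:a, b:]) (t_star n i))) = 0"
    using alternating_poly_sum[of "q * [:a, b:]" n] by simp
  then show ?thesis
    unfolding sum_distrib_left
    by (rule trans[rotated], intro sum.cong refl)
       (use n in \<open>simp add: poly_cheb_t_star algebra_simps\<close>)
qed

text \<open>The polynomials of degree at most \<open>n - 2\<close> have as many dimensions as there
  are interior points, so each interior weight can be isolated. Applied to a difference of weight
  vectors, this gives uniqueness.\<close>

lemma weights_determined_by_ends:
  fixes d :: "nat \<Rightarrow> real"
  assumes n: "2 \<le> n" and "d 0 = 0" "d n = 0"
    and orth: "\<And>q. degree q \<le> n - 2 \<Longrightarrow>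
      (\<Sum>i=0..n. poly (cheb n) (t_star n i) * poly q (t_star n i) * d i) = 0"
    and j: "j \<le> n"
  shows "d j = 0"
proof (cases "j = 0 \<or> j = n")
  case False
  define I where "I = {1..n-1} - {j}"
  txt \<open>This \<open>q\<close> vanishes at all interior extremal points except \<open>t\<^sub>j\<close>.\<close>
  define q where "q = (\<Prod>i\<in>I. [:- t_star n i, 1:])"
  have "degree q \<le> (\<Sum>i\<in>I. degree [:- t_star n i, 1:])"
    unfolding q_def using degree_prod_sum_le[of I "\<lambda>i. [:- t_star n i, 1:]"] by (simp add: I_def o_def)
  also have "\<dots> = card I" by simp
  also have "card I = n - 2"
  proof -
    have "j \<in> {1..n-1}" using False j by auto
    then show ?thesis unfolding I_def by (subst card_Diff_singleton) auto
  qed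
  finally have "degree q \<le> n - 2" .
  then have 0: "(\<Sum>i=0..n. poly (cheb n) (t_star n i) * poly q (t_star n i) * d i) = 0"
    by (rule orth)
  have qi: "poly q (t_star n i) = (\<Prod>k\<in>I. t_star n i - t_star n k)" for i
    by (simp add: q_def poly_prod)
  have "poly (cheb n) (t_star n i) * poly q (t_star n i) * d i = 0" if "i \<in> {0..n} - {j}" for i
  proof (cases "i \<in> I")
    case True
    then have "poly q (t_star n i) = 0" unfolding qi by (auto simp: I_def)
    then show ?thesis by simp
  next
    case False
    with that have "i = 0 \<or> i = n" by (auto simp: I_def)
    with assms(2,3) show ?thesis by auto
  qed
  then have "(\<Sum>i\<in>{0..n} - {j}. poly (cheb n) (t_star n i) * poly q (t_star n i) * d i) = 0"
    by (intro sum.neutral) blast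
  then have "poly (cheb n) (t_star n j) * poly q (t_star n j) * d j = 0"
    using 0 j sum.remove[of "{0..n}" j "\<lambda>i. poly (cheb n) (t_star n i) * poly q (t_star n i) * d i"]
    by simp
  moreover have "t_star n j \<noteq> t_star n k" if "k \<in> I" for k
  proof -
    have "k \<le> n" "k \<noteq> j" using that by (auto simp: I_def)
    then show ?thesis using inj_onD[OF inj_on_t_star[of n], of j k] n j by auto
  qed
  then have "poly q (t_star n j) \<noteq> 0" by (auto simp: qi I_def)
  ultimately show ?thesis using n j by (simp add: poly_cheb_t_star)
qed (use assms in auto)

lemma sum_pmf_t_star:
  assumes "n > 0" "set_pmf \<xi> \<subseteq> t_star n ` {0..n}"
  shows "(\<Sum>i=0..n. pmf \<xi> (t_star n i)) = 1"
  using expectation_on_t_star[OF assms, of "\<lambda>_. 1"] by simp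

lemma mixture_iff_cheb_orthogonal:
  assumes n: "2 \<le> n"
  shows "(\<exists>\<alpha>\<in>{0..1}. \<forall>A. measure_pmf.prob \<xi> A =
       (1 - \<alpha>) * measure_pmf.prob (xi1 n) A + \<alpha> * measure_pmf.prob (xi2 n) A)
    \<longleftrightarrow> set_pmf \<xi> \<subseteq> t_star n ` {0..n} \<and> cheb_orthogonal n \<xi>"
    (is "?mix \<longleftrightarrow> ?orth")
proof
  assume ?mix
  then obtain \<alpha> where mix: "\<And>A. measure_pmf.prob \<xi> A =
      (1 - \<alpha>) * measure_pmf.prob (xi1 n) A + \<alpha> * measure_pmf.prob (xi2 n) A" by blast
  have pmf: "pmf \<xi> x = (1 - \<alpha>) * pmf (xi1 n) x + \<alpha> * pmf (xi2 n) x" for x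
    using mix[of "{x}"] by (simp add: measure_pmf_single)
  have supp: "set_pmf \<xi> \<subseteq> t_star n ` {0..n}"
  proof
    fix x assume "x \<in> set_pmf \<xi>"
    then have "x \<in> set_pmf (xi1 n) \<or> x \<in> set_pmf (xi2 n)"
      by (auto simp: set_pmf_iff pmf)
    then show "x \<in> t_star n ` {0..n}" using set_pmf_xi1[OF n] set_pmf_xi2[OF n] by blast
  qed
  have w: "pmf \<xi> (t_star n i) = trap_weight n i * (1 + (1 - 2 * \<alpha>) * t_star n i)" if "i \<le> n" for i
    unfolding pmf pmf_xi1_t_star[OF n that] pmf_xi2_t_star[OF n that] by algebra
  have "cheb_orthogonal n \<xi>"
    unfolding cheb_orthogonal_def
  proof (intro allI impI)
    fix q :: "real poly" assume "degree q \<le> n - 2"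
    from cheb_orthogonal_linear_weight[OF n this, of 1 "1 - 2 * \<alpha>"]
    show "measure_pmf.expectation \<xi> (\<lambda>x. poly (cheb n) x * poly q x) = 0"
      using n by (simp add: expectation_on_t_star[OF _ supp] w)
  qed
  with supp show ?orth by blast
next
  assume ?orth
  then have supp: "set_pmf \<xi> \<subseteq> t_star n ` {0..n}" and orth: "cheb_orthogonal n \<xi>" by auto
  have n0: "n > 0" using n by simp
  \<comment> \<open>At -1 only \<open>xi2\<close> has mass and at 1 only \<open>xi1\<close>, in each
    case 1 / n, so these factors reproduce the masses of \<open>\<xi>\<close> at both ends. That
    they add up to 1 follows below from comparing total masses.\<close>
  define \<alpha> where "\<alpha> = real n * pmf \<xi> (t_star n 0)"
  define \<beta> where "\<beta> = real n * pmf \<xi> (t_star n n)"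
  have mixp: "\<beta> * pmf (xi1 n) (t_star n i) + \<alpha> * pmf (xi2 n) (t_star n i)
      = trap_weight n i * ((\<alpha> + \<beta>) + (\<beta> - \<alpha>) * t_star n i)" if "i \<le> n" for i
    unfolding pmf_xi1_t_star[OF n that] pmf_xi2_t_star[OF n that] by algebra
  define d where "d i = pmf \<xi> (t_star n i) - trap_weight n i * ((\<alpha> + \<beta>) + (\<beta> - \<alpha>) * t_star n i)" for i
  have "d i = 0" if "i \<le> n" for i
  proof (rule weights_determined_by_ends[OF n _ _ _ that])
    show "d 0 = 0" using n by (simp add: d_def trap_weight_def \<alpha>_def)
    show "d n = 0" using n by (simp add: d_def trap_weight_def \<beta>_def t_star_n)
    fix q :: "real poly" assume q: "degree q \<le> n - 2"
    have "(\<Sum>i=0..n. poly (cheb n) (t_star n i) * poly q (t_star n i) * pmf \<xi> (t_star n i)) = 0"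
      using orth q expectation_on_t_star[OF n0 supp] by (simp add: cheb_orthogonal_def)
    then show "(\<Sum>i=0..n. poly (cheb n) (t_star n i) * poly q (t_star n i) * d i) = 0"
      using cheb_orthogonal_linear_weight[OF n q, of "\<alpha> + \<beta>" "\<beta> - \<alpha>"]
      by (simp add: d_def right_diff_distrib sum_subtractf)
  qed
  then have pt: "pmf \<xi> (t_star n i) = \<beta> * pmf (xi1 n) (t_star n i) + \<alpha> * pmf (xi2 n) (t_star n i)"
    if "i \<le> n" for i
    using that mixp by (simp add: d_def)
  have "(\<Sum>i=0..n. pmf \<xi> (t_star n i))
      = \<beta> * (\<Sum>i=0..n. pmf (xi1 n) (t_star n i)) + \<alpha> * (\<Sum>i=0..n. pmf (xi2 n) (t_star n i))"
    by (simp add: pt sum.distrib sum_distrib_left)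
  then have "\<beta> + \<alpha> = 1"
    using sum_pmf_t_star[OF n0] supp set_pmf_xi1[OF n] set_pmf_xi2[OF n] by simp
  then have \<beta>: "\<beta> = 1 - \<alpha>" by simp
  have "0 \<le> \<alpha>" "0 \<le> \<beta>" by (auto simp: \<alpha>_def \<beta>_def)
  then have \<alpha>: "\<alpha> \<in> {0..1}" using \<beta> by simp
  have prob: "measure_pmf.prob \<zeta> A = (\<Sum>i=0..n. indicator A (t_star n i) * pmf \<zeta> (t_star n i))"
    if "set_pmf \<zeta> \<subseteq> t_star n ` {0..n}" for \<zeta> A
    using expectation_on_t_star[OF n0 that, of "indicator A"] by simp
  have "measure_pmf.prob \<xi> A =
      (1 - \<alpha>) * measure_pmf.prob (xi1 n) A + \<alpha> * measure_pmf.prob (xi2 n) A" for A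
    unfolding prob[OF supp] prob[OF set_pmf_xi1[OF n]] prob[OF set_pmf_xi2[OF n]]
    unfolding sum_distrib_left sum.distrib[symmetric]
    by (rule sum.cong) (auto simp: pt \<beta> algebra_simps)
  with \<alpha> show ?mix by blast
qed

subsection \<open>The criterion\<close>

text \<open>The restriction makes the coefficient function extensional, as membership in
  \<open>params\<close> demands.\<close>

lemma poly_model_restrict_coeff:
  assumes "degree p \<le> d"
  shows "poly_model d x (restrict (coeff p) {0..d}) = poly p x"
proof -
  have "poly p x = (\<Sum>j\<le>d. coeff p j * x ^ j)"
    unfolding poly_altdef
    by (rule sum.mono_neutral_left) (use assms in \<open>auto simp: coeff_eq_0\<close>)
  then show ?thesis by (simp add: poly_model_def atLeast0AtMost)
qed

lemma poly_model_eq_poly: "poly_model d x \<theta> = poly (\<Sum>j=0..d. monom (\<theta> j) j) x"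
  by (simp add: poly_model_def poly_sum poly_monom)

lemma degree_sum_monom: "degree (\<Sum>j=0..d. monom (\<theta> j :: real) j) \<le> d"
  by (rule degree_sum_le) (auto intro: order_trans[OF degree_monom_le])

lemma expectation_finite:
  "finite (set_pmf \<xi>) \<Longrightarrow> measure_pmf.expectation \<xi> f = (\<Sum>x\<in>set_pmf \<xi>. f x * pmf \<xi> x)"
  for \<xi> :: "real pmf" and f :: "real \<Rightarrow> real"
  by (rule integral_measure_pmf_real) auto

locale cheb_model =
  fixes n :: nat and \<theta>1 :: "nat \<Rightarrow> real"
  assumes n: "2 \<le> n" and lead: "\<theta>1 n \<noteq> 0" and sub: "\<theta>1 (n - 1) = 0"
begin

definition c :: real where "c = \<theta>1 n / 2 ^ (n - 1)"

definition err :: "real pmf \<Rightarrow> real poly \<Rightarrow> real" where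
  "err \<xi> q = measure_pmf.expectation \<xi> (\<lambda>x. (c * poly (cheb n) x - poly q x)\<^sup>2)"

abbreviation crit :: "real pmf \<Rightarrow> real" where
  "crit \<equiv> T_criterion (poly_model n) \<theta>1 (poly_model (n - 2)) (params (n - 2))"

lemma c_nonzero: "c \<noteq> 0"
  using lead by (simp add: c_def)

text \<open>Since \<open>cheb n\<close> has leading coefficient \<open>2 ^ (n - 1)\<close>, the
  choice of \<open>c\<close> cancels degree \<open>n\<close>. In degree \<open>n - 1\<close> both
  coefficients are zero.\<close>

lemma best_residual:
  "\<exists>r. degree r \<le> n - 2 \<and> (\<forall>x. poly_model n x \<theta>1 = c * poly (cheb n) x + poly r x)"
proof -
  define p where "p = (\<Sum>j=0..n. monom (\<theta>1 j) j)"
  have p: "coeff p i = (if i \<le> n then \<theta>1 i else 0)" for i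
    by (simp add: p_def coeff_sum)
  define r where "r = p - smult c (cheb n)"
  have "degree r \<le> n - 2"
  proof (rule degree_le, intro allI impI)
    fix i assume "n - 2 < i"
    then consider "i = n - 1" | "i = n" | "i > n" using n by linarith
    then show "coeff r i = 0"
    proof cases
      case 1
      have "coeff (cheb n) (n - 1) = 0" using coeff_cheb_subtop[of "n - 1"] n by simp
      with 1 sub show ?thesis by (simp add: r_def p)
    next
      case 2
      have "coeff (cheb n) n = 2 ^ (n - 1)" using coeff_cheb_top[of "n - 1"] n by simp
      with 2 show ?thesis by (simp add: r_def p c_def)
    next
      case 3
      then have "coeff (cheb n) i = 0" using degree_cheb[of n] by (intro coeff_eq_0) auto
      with 3 show ?thesis by (simp add: r_def p)
    qed
  qed
  moreover have "poly_model n x \<theta>1 = c * poly (cheb n) x + poly r x" for x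
    by (simp add: poly_model_eq_poly r_def p_def)
  ultimately show ?thesis by blast
qed

text \<open>Shifting by the remainder from \<open>best_residual\<close> maps the polynomials of
  degree at most \<open>n - 2\<close> onto themselves, so both infima are over the same set of
  values.\<close>

lemma crit_eq: "crit \<xi> = (INF q\<in>{q. degree q \<le> n - 2}. err \<xi> q)"
proof -
  obtain r where r: "degree r \<le> n - 2"
    "\<And>x. poly_model n x \<theta>1 = c * poly (cheb n) x + poly r x" using best_residual by blast
  let ?E = "\<lambda>\<theta>. measure_pmf.expectation \<xi> (\<lambda>x. (poly_model n x \<theta>1 - poly_model (n - 2) x \<theta>)\<^sup>2)"
  have "?E ` params (n - 2) = err \<xi> ` {q. degree q \<le> n - 2}"
  proof (intro equalityI subsetI)
    fix y assume "y \<in> ?E ` params (n - 2)"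
    then obtain \<theta> where "y = ?E \<theta>" by blast
    then have "y = err \<xi> ((\<Sum>j=0..n-2. monom (\<theta> j) j) - r)"
      by (simp add: err_def r poly_model_eq_poly[of "n - 2"] algebra_simps)
    moreover have "degree ((\<Sum>j=0..n-2. monom (\<theta> j) j) - r) \<le> n - 2"
      by (intro degree_diff_le degree_sum_monom r)
    ultimately show "y \<in> err \<xi> ` {q. degree q \<le> n - 2}" by blast
  next
    fix y assume "y \<in> err \<xi> ` {q. degree q \<le> n - 2}"
    then obtain q where q: "degree q \<le> n - 2" "y = err \<xi> q" by blast
    have "degree (q + r) \<le> n - 2" by (intro degree_add_le q r)
    then have "y = ?E (restrict (coeff (q + r)) {0..n-2})"
      by (simp add: poly_model_restrict_coeff err_def q r algebra_simps del: coeff_add)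
    moreover have "restrict (coeff (q + r)) {0..n-2} \<in> params (n - 2)"
      by (simp add: params_def)
    ultimately show "y \<in> ?E ` params (n - 2)" by blast
  qed
  then show ?thesis by (simp add: T_criterion_def)
qed

section \<open>Bounds on the criterion and its maximum\<close>

lemma crit_le_err: "degree q \<le> n - 2 \<Longrightarrow> crit \<xi> \<le> err \<xi> q"
  unfolding crit_eq
  by (rule cINF_lower) (auto simp: err_def intro!: bdd_belowI2[of _ 0] Bochner_Integration.integral_nonneg)

lemma crit_ge: "(\<And>q. degree q \<le> n - 2 \<Longrightarrow> a \<le> err \<xi> q) \<Longrightarrow> a \<le> crit \<xi>"
  unfolding crit_eq by (rule cINF_greatest) (auto intro: exI[of _ 0])

lemma err_0_le:
  assumes "design \<xi>"
  shows "err \<xi> 0 \<le> c\<^sup>2"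
proof -
  have fin: "finite (set_pmf \<xi>)" using assms by (simp add: design_def)
  have "err \<xi> 0 \<le> measure_pmf.expectation \<xi> (\<lambda>x. c\<^sup>2)"
    unfolding err_def
  proof (rule integral_mono_AE)
    show "AE x in \<xi>. (c * poly (cheb n) x - poly 0 x)\<^sup>2 \<le> c\<^sup>2"
    proof (rule AE_pmfI)
      fix x assume "x \<in> set_pmf \<xi>"
      then have "(poly (cheb n) x)\<^sup>2 \<le> 1" using assms by (intro cheb_sq_le_1) (auto simp: design_def)
      then show "(c * poly (cheb n) x - poly 0 x)\<^sup>2 \<le> c\<^sup>2"
        by (simp add: power_mult_distrib mult_left_le)
    qed
  qed (use fin in \<open>auto intro: integrable_measure_pmf_finite\<close>)
  then show ?thesis by simp
qed

lemma err_expand: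
  assumes "finite (set_pmf \<xi>)"
  shows "err \<xi> q = err \<xi> 0
    - 2 * c * measure_pmf.expectation \<xi> (\<lambda>x. poly (cheb n) x * poly q x)
    + measure_pmf.expectation \<xi> (\<lambda>x. (poly q x)\<^sup>2)"
proof -
  have "(c * poly (cheb n) x - poly q x)\<^sup>2 * pmf \<xi> x
      = (c * poly (cheb n) x - poly 0 x)\<^sup>2 * pmf \<xi> x
        - 2 * c * (poly (cheb n) x * poly q x * pmf \<xi> x) + (poly q x)\<^sup>2 * pmf \<xi> x" for x
    by (simp add: power2_eq_square algebra_simps)
  then show ?thesis
    unfolding err_def expectation_finite[OF assms]
    by (simp only: sum.distrib sum_subtractf sum_distrib_left)
qed

text \<open>Testing with \<open>q = 0\<close> forces equality in \<open>err_0_le\<close>, hence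
  T_n^2 = 1 on the support, and testing with multiples of \<open>q\<close> gives orthogonality.
  Conversely, orthogonality removes the cross term in \<open>err_expand\<close>.\<close>

lemma c_sq_le_crit_iff:
  assumes "design \<xi>"
  shows "c\<^sup>2 \<le> crit \<xi> \<longleftrightarrow> set_pmf \<xi> \<subseteq> t_star n ` {0..n} \<and> cheb_orthogonal n \<xi>"
proof -
  have fin: "finite (set_pmf \<xi>)" and sub: "set_pmf \<xi> \<subseteq> {-1..1}"
    using assms by (auto simp: design_def)
  have n0: "n > 0" using n by simp
  show ?thesis
  proof
    assume le: "c\<^sup>2 \<le> crit \<xi>"
    have e0: "err \<xi> 0 = c\<^sup>2" using le crit_le_err[of 0 \<xi>] err_0_le[OF assms] by simp
    \<comment> \<open>The gap between c^2 and \<open>err \<xi> 0\<close> is a sum of nonnegative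
      terms, which must all vanish.\<close>
    have "(\<Sum>x\<in>set_pmf \<xi>. c\<^sup>2 * (1 - (poly (cheb n) x)\<^sup>2) * pmf \<xi> x)
        = c\<^sup>2 * (\<Sum>x\<in>set_pmf \<xi>. pmf \<xi> x) - err \<xi> 0"
      unfolding err_def expectation_finite[OF fin] sum_distrib_left sum_subtractf[symmetric]
      by (rule sum.cong) (simp_all add: algebra_simps power_mult_distrib)
    also have "\<dots> = 0" using e0 sum_pmf_eq_1[OF fin order_refl] by simp
    finally have "\<forall>x\<in>set_pmf \<xi>. c\<^sup>2 * (1 - (poly (cheb n) x)\<^sup>2) * pmf \<xi> x = 0"
      by (subst (asm) sum_nonneg_eq_0_iff[OF fin]) (use sub cheb_sq_le_1 in auto)
    then have "(poly (cheb n) x)\<^sup>2 = 1" if "x \<in> set_pmf \<xi>" for x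
      using that c_nonzero by (auto simp: set_pmf_iff)
    then have "set_pmf \<xi> \<subseteq> t_star n ` {0..n}"
      using cheb_sq_eq_1_imp[OF n0] sub by blast
    moreover have "cheb_orthogonal n \<xi>"
      unfolding cheb_orthogonal_def
    proof (intro allI impI)
      fix q :: "real poly" assume q: "degree q \<le> n - 2"
      define b where "b = measure_pmf.expectation \<xi> (\<lambda>x. poly (cheb n) x * poly q x)"
      define v where "v = measure_pmf.expectation \<xi> (\<lambda>x. (poly q x)\<^sup>2)"
      have "v \<ge> 0" unfolding v_def by (rule Bochner_Integration.integral_nonneg) simp
      \<comment> \<open>Zero is a best approximation, so moving away from it by \<open>s\<close>
        times \<open>q\<close> cannot lower the error.\<close>
      have quad: "2 * c * s * b \<le> s\<^sup>2 * v" for s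
      proof -
        have "degree (smult s q) \<le> n - 2" using q degree_smult_le[of s q] by linarith
        then have "err \<xi> 0 \<le> err \<xi> (smult s q)"
          using le e0 crit_le_err[of "smult s q" \<xi>] by simp
        moreover have "err \<xi> (smult s q) = err \<xi> 0 - 2 * c * (s * b) + s\<^sup>2 * v"
          unfolding err_expand[OF fin, of "smult s q"] b_def v_def
          by (simp add: power_mult_distrib mult.left_commute[of _ s])
        ultimately show ?thesis by (simp add: mult_ac)
      qed
      txt \<open>The minimizer would be \<open>c * b / v\<close>; the \<open>+ 1\<close> covers the case \<open>v = 0\<close>.\<close>
      define s where "s = c * b / (v + 1)"
      have "2 * (c * b) * s \<le> s * s * v" using quad[of s] by (simp add: power2_eq_square mult_ac)
      moreover have "c * b = s * (v + 1)" using \<open>v \<ge> 0\<close> by (simp add: s_def)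
      \<comment> \<open>Inserting c b = s (v + 1) turns the bound into 2 s^2 (v + 1) \<le> s^2
        v.\<close>
      ultimately have "s * s * (v + 2) \<le> 0" by (simp only:) (simp add: algebra_simps)
      then have "s = 0" using \<open>v \<ge> 0\<close> by (auto simp: mult_le_0_iff zero_le_mult_iff)
      then have "c * b = 0" using \<open>c * b = s * (v + 1)\<close> by simp
      then have "b = 0" using c_nonzero by simp
      then show "measure_pmf.expectation \<xi> (\<lambda>x. poly (cheb n) x * poly q x) = 0"
        by (simp add: b_def)
    qed
    ultimately show "set_pmf \<xi> \<subseteq> t_star n ` {0..n} \<and> cheb_orthogonal n \<xi>" by blast
  next
    assume "set_pmf \<xi> \<subseteq> t_star n ` {0..n} \<and> cheb_orthogonal n \<xi>"
    then have supp: "set_pmf \<xi> \<subseteq> t_star n ` {0..n}" and orth: "cheb_orthogonal n \<xi>" by auto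
    have "poly (cheb n) (t_star n i) ^ 2 = 1" if "i \<le> n" for i
      using poly_cheb_t_star[OF that n0] by (simp add: power_mult_distrib flip: power_mult)
    then have "err \<xi> 0 = (\<Sum>i=0..n. c\<^sup>2 * pmf \<xi> (t_star n i))"
      unfolding err_def expectation_on_t_star[OF n0 supp] by (simp add: power_mult_distrib)
    then have "err \<xi> 0 = c\<^sup>2"
      using sum_pmf_t_star[OF n0 supp] by (simp flip: sum_distrib_left)
    then show "c\<^sup>2 \<le> crit \<xi>"
    proof (intro crit_ge)
      fix q :: "real poly" assume "degree q \<le> n - 2"
      then have "err \<xi> q = c\<^sup>2 + measure_pmf.expectation \<xi> (\<lambda>x. (poly q x)\<^sup>2)"
        using orth \<open>err \<xi> 0 = c\<^sup>2\<close> by (simp add: err_expand[OF fin, of q] cheb_orthogonal_def)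
      then show "c\<^sup>2 \<le> err \<xi> q" by simp
    qed
  qed
qed

lemma crit_le: "design \<xi> \<Longrightarrow> crit \<xi> \<le> c\<^sup>2"
  using crit_le_err[of 0 \<xi>] err_0_le[of \<xi>] by simp

text \<open>As the mixture with \<alpha> = 0, \<open>xi1\<close> attains the upper bound of
  \<open>crit_le\<close>, so c^2 is the maximal criterion value.\<close>

lemma c_sq_le_crit_xi1: "design (xi1 n)" "c\<^sup>2 \<le> crit (xi1 n)"
proof -
  show d: "design (xi1 n)"
    using set_pmf_xi1[OF n] t_star_bounds[of n]
    unfolding design_def by (meson finite_atLeastAtMost finite_imageI finite_subset image_subset_iff subset_trans)
  have "\<exists>\<alpha>\<in>{0..1}. \<forall>A. measure_pmf.prob (xi1 n) A =
       (1 - \<alpha>) * measure_pmf.prob (xi1 n) A + \<alpha> * measure_pmf.prob (xi2 n) A"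
    by (rule bexI[of _ 0]) auto
  then show "c\<^sup>2 \<le> crit (xi1 n)"
    unfolding c_sq_le_crit_iff[OF d] mixture_iff_cheb_orthogonal[OF n] .
qed

lemma T_optimal_iff:
  assumes "design \<xi>"
  shows "T_optimal (poly_model n) \<theta>1 (poly_model (n - 2)) (params (n - 2)) \<xi> \<longleftrightarrow> c\<^sup>2 \<le> crit \<xi>"
  unfolding T_optimal_def using assms crit_le c_sq_le_crit_xi1 by (meson order_trans)

end

theorem theorem3p1:
  fixes n :: nat and \<theta>1 :: "nat \<Rightarrow> real" and \<xi> :: "real pmf"
  assumes "2 \<le> n"
    and "\<theta>1 \<in> params n"
    and "\<theta>1 n \<noteq> 0"
    and "\<theta>1 (n - 1) = 0"
    and "design \<xi>"
  shows "T_optimal (poly_model n) \<theta>1 (poly_model (n - 2)) (params (n - 2)) \<xi> \<longleftrightarrow>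
    (\<exists>\<alpha>\<in>{0..1}. \<forall>A. measure_pmf.prob \<xi> A =
       (1 - \<alpha>) * measure_pmf.prob (xi1 n) A + \<alpha> * measure_pmf.prob (xi2 n) A)"
proof -
  interpret cheb_model n \<theta>1
    using assms(1,3,4) by unfold_locales
  show ?thesis
    unfolding T_optimal_iff[OF assms(5)] c_sq_le_crit_iff[OF assms(5)]
    by (rule mixture_iff_cheb_orthogonal[OF assms(1), symmetric])
qed

end
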